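(* For every $2<p<\infty$ there is a function $g\in L^p(\mathbb R)$ such that the system of translates $\{g(x-j)\}_{j=1}^\infty$ is an unconditional basic sequence in $L^p(\mathbb R)$, but it is not equivalent to any subsequence of the standard unit vector basis of $\ell^p(\ell^2)$.
   Context: An unconditional basic sequence is an unconditional basis of its closed linear span. $\ell^p(\ell^2)=(\ell^2\oplus\ell^2\oplus\cdots)_p$ is the space of sequences $(x_n)$, $x_n\in\ell^2$, with norm $(\sum_n\|x_n\|_2^p)^{1/p}$; its standard unit vector basis is $\{\delta_{n,m}\}_{n,m\ge1}$ ($m$-th unit vector of the $n$-th copy). A system $\{u_j\}_{j\ge1}$ is equivalent to a subsequence of a system $\{v_i\}_{i\in I}$ if there is an injection $\sigma:\{1,2,\dots\}\to I$ with $\|\sum a_ju_j\|\asymp\|\sum a_jv_{\sigma(j)}\|$ for all finitely supported scalars, constants independent of the scalars. *)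

theory Defs
  imports "HOL-Analysis.Analysis"
begin

definition in_Lp :: "real \<Rightarrow> (real \<Rightarrow> real) \<Rightarrow> bool" where
  "in_Lp p f \<longleftrightarrow> f \<in> borel_measurable lborel \<and> integrable lborel (\<lambda>x. \<bar>f x\<bar> powr p)"

definition Lp_norm :: "real \<Rightarrow> (real \<Rightarrow> real) \<Rightarrow> real" where
  "Lp_norm p f = (\<integral>x. \<bar>f x\<bar> powr p \<partial>lborel) powr (1 / p)"

definition in_closed_span :: "real \<Rightarrow> (nat \<Rightarrow> real \<Rightarrow> real) \<Rightarrow> (real \<Rightarrow> real) \<Rightarrow> bool" where
  "in_closed_span p u f \<longleftrightarrow> in_Lp p f \<and>
     (\<forall>e>0. \<exists>F a. finite F \<and> Lp_norm p (\<lambda>x. f x - (\<Sum>j\<in>F. a j * u j x)) < e)"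

definition uncond_expansion :: "real \<Rightarrow> (nat \<Rightarrow> real) \<Rightarrow> (nat \<Rightarrow> real \<Rightarrow> real) \<Rightarrow> (real \<Rightarrow> real) \<Rightarrow> bool" where
  "uncond_expansion p a u f \<longleftrightarrow>
     (\<forall>e>0. \<exists>F0. finite F0 \<and> (\<forall>F. finite F \<and> F0 \<subseteq> F \<longrightarrow>
        Lp_norm p (\<lambda>x. f x - (\<Sum>j\<in>F. a j * u j x)) < e))"

definition uncond_basic_seq :: "real \<Rightarrow> (nat \<Rightarrow> real \<Rightarrow> real) \<Rightarrow> bool" where
  "uncond_basic_seq p u \<longleftrightarrow> (\<forall>j. in_Lp p (u j)) \<and>
     (\<forall>f. in_closed_span p u f \<longrightarrow>
        (\<exists>a. uncond_expansion p a u f) \<and>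
        (\<forall>a b. uncond_expansion p a u f \<and> uncond_expansion p b u f \<longrightarrow> a = b))"

(* norm in l^p(l^2) of  sum_{j in F} a j * delta_{sigma j}  (sigma injective),
   where delta_{(n,m)} is the m-th unit vector of the n-th copy of l^2 *)
definition lp_l2_norm :: "real \<Rightarrow> (nat \<Rightarrow> nat \<times> nat) \<Rightarrow> nat set \<Rightarrow> (nat \<Rightarrow> real) \<Rightarrow> real" where
  "lp_l2_norm p \<sigma> F a =
     (\<Sum>n\<in>fst ` \<sigma> ` F. (\<Sum>j\<in>{j\<in>F. fst (\<sigma> j) = n}. (a j)\<^sup>2) powr (p / 2)) powr (1 / p)"

definition equiv_to_lp_l2_subseq :: "real \<Rightarrow> (nat \<Rightarrow> real \<Rightarrow> real) \<Rightarrow> bool" where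
  "equiv_to_lp_l2_subseq p u \<longleftrightarrow>
     (\<exists>\<sigma>::nat \<Rightarrow> nat \<times> nat. inj \<sigma> \<and> (\<exists>A B. 0 < A \<and> 0 < B \<and>
        (\<forall>F a. finite F \<longrightarrow>
           A * lp_l2_norm p \<sigma> F a \<le> Lp_norm p (\<lambda>x. \<Sum>j\<in>F. a j * u j x) \<and>
           Lp_norm p (\<lambda>x. \<Sum>j\<in>F. a j * u j x) \<le> B * lp_l2_norm p \<sigma> F a)))"

end

theory Submission
  imports Defs
begin

text \<open>
  Let \<open>g = r\<^sub>k / sqrt (k + 1)\<close> on \<open>[k, k + 1)\<close> for \<open>k \<ge> 0\<close>, with \<open>r\<^sub>k\<close> the Rademacher functions, and
  \<open>g = 0\<close> on the negative half-line. On each window \<open>[m, m + 1)\<close> the translates restrict to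
  distinct Rademacher functions, so Khinchin's inequality shows that \<open>\<parallel>\<Sum>j. a\<^sub>j g(x - j)\<parallel>\<close> to the
  power \<open>p\<close> is comparable to \<open>\<Sum>m. (\<Sum>j<m. a\<^sub>j\<^sup>2 / (m - j)) powr (p/2)\<close>.
  The latter is monotone in the support of \<open>a\<close>, whence unconditionality.

  Suppose that the system is equivalent to a subsequence of the basis of \<open>\<ell>\<^sup>p(\<ell>\<^sup>2)\<close>, which splits
  the indices into classes, one for each copy of \<open>\<ell>\<^sup>2\<close>. The weights \<open>1 / k\<close> are
  \<open>p/2\<close>-summable, so for widely separated indices the system behaves like the basis of
  \<open>\<ell>\<^sup>p\<close>. As \<open>p > 2\<close>, this bounds the size of the classes, so that the whole system is
  equivalent to the basis of \<open>\<ell>\<^sup>p\<close>. But \<open>\<parallel>\<Sum>j<2N. g(x - j)\<parallel>\<close> to the power \<open>p\<close> is at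
  least of order \<open>N (ln N) powr (p/2)\<close>, since the weights are not summable.
\<close>

section \<open>The seminorm of \<open>L\<^sup>p\<close>\<close>

lemma in_Lp_integrable: "in_Lp p f \<Longrightarrow> integrable lborel (\<lambda>x. \<bar>f x\<bar> powr p)"
  by (simp add: in_Lp_def)

lemma Lp_norm_nonneg [simp]: "0 \<le> Lp_norm p f"
  by (simp add: Lp_norm_def)

lemma Lp_norm_powr:
  assumes "0 < p"
  shows "Lp_norm p f powr p = (\<integral>x. \<bar>f x\<bar> powr p \<partial>lborel)"
  using assms by (simp add: Lp_norm_def powr_powr integral_nonneg_AE)

lemma Lp_norm_le_iff:
  assumes "0 < p" "0 \<le> c"
  shows "Lp_norm p f \<le> c \<longleftrightarrow> (\<integral>x. \<bar>f x\<bar> powr p \<partial>lborel) \<le> c powr p"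
  using assms Lp_norm_powr[of p f] powr_mono2[of p "Lp_norm p f" c]
    powr_less_mono2[of p c "Lp_norm p f"]
  by (metis Lp_norm_nonneg leD leI less_eq_real_def)

lemma in_Lp_zero: "in_Lp p (\<lambda>x. 0)"
  by (simp add: in_Lp_def)

lemma in_Lp_scale:
  assumes "in_Lp p f"
  shows "in_Lp p (\<lambda>x. c * f x)"
  using assms by (auto simp: in_Lp_def abs_mult powr_mult)

text \<open>The modulus of the sum is at most twice the larger of the two moduli.\<close>

lemma abs_add_powr_le:
  fixes x y p :: real
  assumes "0 \<le> p"
  shows "\<bar>x + y\<bar> powr p \<le> 2 powr p * (\<bar>x\<bar> powr p + \<bar>y\<bar> powr p)"
proof -
  have "\<bar>x + y\<bar> powr p \<le> (2 * max \<bar>x\<bar> \<bar>y\<bar>) powr p"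
    using assms by (intro powr_mono2) auto
  also have "\<dots> = 2 powr p * max \<bar>x\<bar> \<bar>y\<bar> powr p"
    by (simp add: powr_mult)
  also have "\<dots> \<le> 2 powr p * (\<bar>x\<bar> powr p + \<bar>y\<bar> powr p)"
    by (intro mult_left_mono) (auto simp: max_def)
  finally show ?thesis .
qed

lemma in_Lp_add:
  assumes "0 < p" "in_Lp p f" "in_Lp p g"
  shows "in_Lp p (\<lambda>x. f x + g x)"
proof -
  have [measurable]: "f \<in> borel_measurable borel" "g \<in> borel_measurable borel"
    using assms by (auto simp: in_Lp_def)
  have "integrable lborel (\<lambda>x. 2 powr p * (\<bar>f x\<bar> powr p + \<bar>g x\<bar> powr p))"
    using assms by (auto simp: in_Lp_def)
  then have "integrable lborel (\<lambda>x. \<bar>f x + g x\<bar> powr p)"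
    by (rule Bochner_Integration.integrable_bound)
      (use assms abs_add_powr_le[of p] in \<open>auto simp: abs_of_nonneg\<close>)
  then show ?thesis
    by (simp add: in_Lp_def)
qed

lemma in_Lp_diff:
  assumes "0 < p" "in_Lp p f" "in_Lp p g"
  shows "in_Lp p (\<lambda>x. f x - g x)"
  using in_Lp_add[OF assms(1,2) in_Lp_scale[OF assms(3), of "-1"]] by simp

lemma in_Lp_sum:
  assumes "0 < p" "\<And>j. j \<in> F \<Longrightarrow> in_Lp p (u j)"
  shows "in_Lp p (\<lambda>x. \<Sum>j\<in>F. a j * u j x)"
  using assms(2)
proof (induction F rule: infinite_finite_induct)
  case (insert j F)
  then show ?case
    using in_Lp_add[OF assms(1) in_Lp_scale[of p "u j" "a j"]] by auto
qed (auto simp: in_Lp_zero)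

lemma Lp_norm_scale:
  assumes "0 < p"
  shows "Lp_norm p (\<lambda>x. c * f x) = \<bar>c\<bar> * Lp_norm p f"
  using assms by (simp add: Lp_norm_def abs_mult powr_mult powr_powr)

lemma Lp_norm_minus: "Lp_norm p (\<lambda>x. f x - g x) = Lp_norm p (\<lambda>x. g x - f x)"
  by (simp add: Lp_norm_def abs_minus_commute)

lemma Lp_norm_zero [simp]: "Lp_norm p (\<lambda>x. 0) = 0"
  by (simp add: Lp_norm_def)

text \<open>On the positive half-line this is convexity; if an argument vanishes, it reduces to
  \<open>r powr p \<le> r\<close> for a weight \<open>r\<close> in the unit interval.\<close>

lemma powr_convex_nonneg:
  fixes x y p s t :: real
  assumes p: "1 \<le> p" and "0 \<le> x" "0 \<le> y" "0 \<le> s" "0 \<le> t" "s + t = 1"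
  shows "(s * x + t * y) powr p \<le> s * x powr p + t * y powr p"
proof (cases "x = 0 \<or> y = 0")
  case True
  have "r powr p \<le> r" if "0 \<le> r" "r \<le> 1" for r :: real
    using that p powr_mono'[of 1 p r] by (cases "r = 0") auto
  then have "s powr p * x powr p \<le> s * x powr p" "t powr p * y powr p \<le> t * y powr p"
    using assms by (auto intro!: mult_right_mono)
  then show ?thesis
    using True assms by (auto simp: powr_mult)
next
  case False
  have s: "1 - t = s"
    using assms by simp
  show ?thesis
    using convex_onD[OF powr_convex[OF p], of t x y] False assms unfolding s by simp
qed

text \<open>With arbitrary \<open>s > \<parallel>f\<parallel>\<close> and \<open>t > \<parallel>g\<parallel>\<close>, convexity of \<open>z powr p\<close> is applied to
  \<open>(\<bar>f\<bar> + \<bar>g\<bar>) / (s + t)\<close> as a convex combination of \<open>\<bar>f\<bar> / s\<close> and \<open>\<bar>g\<bar> / t\<close>.\<close>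

lemma Lp_norm_triangle:
  assumes p: "1 \<le> p" and f: "in_Lp p f" and g: "in_Lp p g"
  shows "Lp_norm p (\<lambda>x. f x + g x) \<le> Lp_norm p f + Lp_norm p g"
proof (rule field_le_epsilon)
  fix e :: real assume e: "0 < e"
  define s where "s = Lp_norm p f + e / 2"
  define t where "t = Lp_norm p g + e / 2"
  have s: "0 < s" "Lp_norm p f \<le> s" and t: "0 < t" "Lp_norm p g \<le> t"
    using e by (simp_all add: s_def t_def add_nonneg_pos)
  have int: "integrable lborel (\<lambda>x. \<bar>f x\<bar> powr p)" "integrable lborel (\<lambda>x. \<bar>g x\<bar> powr p)"
    using f g by (auto simp: in_Lp_def)
  have st: "s + t \<noteq> 0" "s / (s + t) + t / (s + t) = 1"
    using s t by (simp_all flip: add_divide_distrib)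
  have pt: "\<bar>f x + g x\<bar> powr p \<le> (s + t) powr p *
      (s / (s + t) * (\<bar>f x\<bar> powr p / s powr p) + t / (s + t) * (\<bar>g x\<bar> powr p / t powr p))" for x
  proof -
    have "\<bar>f x + g x\<bar> powr p \<le> (\<bar>f x\<bar> + \<bar>g x\<bar>) powr p"
      using p by (intro powr_mono2) auto
    also have "\<bar>f x\<bar> + \<bar>g x\<bar> = (s + t) * (s / (s + t) * (\<bar>f x\<bar> / s) + t / (s + t) * (\<bar>g x\<bar> / t))"
      using s t st(1) by (simp add: distrib_left)
    also have "\<dots> powr p = (s + t) powr p * (s / (s + t) * (\<bar>f x\<bar> / s) + t / (s + t) * (\<bar>g x\<bar> / t)) powr p"
      using s t by (simp add: powr_mult)
    also have "(s / (s + t) * (\<bar>f x\<bar> / s) + t / (s + t) * (\<bar>g x\<bar> / t)) powr p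
        \<le> s / (s + t) * (\<bar>f x\<bar> / s) powr p + t / (s + t) * (\<bar>g x\<bar> / t) powr p"
      using s t by (intro powr_convex_nonneg p st) simp_all
    finally show ?thesis
      using s t by (simp add: powr_divide)
  qed
  have "(\<integral>x. \<bar>f x + g x\<bar> powr p \<partial>lborel) \<le> (\<integral>x. (s + t) powr p *
      (s / (s + t) * (\<bar>f x\<bar> powr p / s powr p) + t / (s + t) * (\<bar>g x\<bar> powr p / t powr p)) \<partial>lborel)"
    using int pt in_Lp_integrable[OF in_Lp_add[OF _ f g]] p by (intro integral_mono) auto
  also have "\<dots> = (s + t) powr p * (s / (s + t) * (Lp_norm p f powr p / s powr p)
      + t / (s + t) * (Lp_norm p g powr p / t powr p))"
    using int p by (simp add: Lp_norm_powr)
  also have "\<dots> \<le> (s + t) powr p * (s / (s + t) * 1 + t / (s + t) * 1)"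
    using s t p by (intro mult_left_mono add_mono) (auto intro!: powr_mono2)
  also have "\<dots> = (s + t) powr p"
    using st(2) by simp
  finally have "Lp_norm p (\<lambda>x. f x + g x) \<le> s + t"
    using p s t by (simp add: Lp_norm_le_iff)
  then show "Lp_norm p (\<lambda>x. f x + g x) \<le> Lp_norm p f + Lp_norm p g + e"
    by (simp add: s_def t_def)
qed

lemma Lp_norm_triangle_diff:
  assumes "1 \<le> p" "in_Lp p f" "in_Lp p g" "in_Lp p h"
  shows "Lp_norm p (\<lambda>x. f x - h x) \<le> Lp_norm p (\<lambda>x. f x - g x) + Lp_norm p (\<lambda>x. g x - h x)"
  using Lp_norm_triangle[OF assms(1), of "\<lambda>x. f x - g x" "\<lambda>x. g x - h x"]
    in_Lp_diff[of p f g] in_Lp_diff[of p g h] assms by simp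

lemma Lp_norm_sum_le:
  assumes "1 \<le> p" "\<And>j. j \<in> F \<Longrightarrow> in_Lp p (u j)"
  shows "Lp_norm p (\<lambda>x. \<Sum>j\<in>F. a j * u j x) \<le> (\<Sum>j\<in>F. \<bar>a j\<bar> * Lp_norm p (u j))"
  using assms(2)
proof (induction F rule: infinite_finite_induct)
  case (insert j F)
  have "Lp_norm p (\<lambda>x. \<Sum>j\<in>insert j F. a j * u j x)
      = Lp_norm p (\<lambda>x. a j * u j x + (\<Sum>j\<in>F. a j * u j x))"
    using insert.hyps by simp
  also have "\<dots> \<le> Lp_norm p (\<lambda>x. a j * u j x) + Lp_norm p (\<lambda>x. \<Sum>j\<in>F. a j * u j x)"
    using insert.prems assms(1) by (intro Lp_norm_triangle in_Lp_scale in_Lp_sum) auto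
  finally show ?case
    using insert assms(1) by (simp add: Lp_norm_scale)
qed auto

section \<open>Sequences with bounded suppression constant\<close>

text \<open>Projections onto coordinate subsets are uniformly bounded on finite sums. This finite
  form of unconditionality is what monotone square functions deliver, and it implies
  \<open>uncond_basic_seq\<close>.\<close>

locale suppression_seq =
  fixes p K :: real and u :: "nat \<Rightarrow> real \<Rightarrow> real"
  assumes p: "1 \<le> p" and K: "0 < K"
    and in_Lp: "\<And>j. in_Lp p (u j)"
    and nonzero: "\<And>j. 0 < Lp_norm p (u j)"
    and suppression: "\<And>F G a. finite F \<Longrightarrow> G \<subseteq> F \<Longrightarrow>
      Lp_norm p (\<lambda>x. \<Sum>j\<in>G. a j * u j x) \<le> K * Lp_norm p (\<lambda>x. \<Sum>j\<in>F. a j * u j x)"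
begin

abbreviation S :: "nat set \<Rightarrow> (nat \<Rightarrow> real) \<Rightarrow> real \<Rightarrow> real" where
  "S F a \<equiv> \<lambda>x. \<Sum>j\<in>F. a j * u j x"

lemma in_Lp_S: "in_Lp p (S F a)"
  using p in_Lp by (intro in_Lp_sum) auto

text \<open>Suppressing all indices but one bounds the coefficient functionals, uniformly in
  \<open>F\<close>.\<close>

lemma coeff_le:
  assumes "finite F" "j \<in> F"
  shows "\<bar>a j\<bar> * Lp_norm p (u j) \<le> K * Lp_norm p (S F a)"
  using suppression[of F "{j}" a] assms p by (simp add: Lp_norm_scale)

text \<open>Over large finite sets both sums are close to \<open>f\<close>, so the sum with
  coefficients \<open>a j - b j\<close> is small, and \<open>coeff_le\<close> passes this on to each
  coefficient.\<close>

lemma expansion_unique: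
  assumes f: "in_Lp p f" and a: "uncond_expansion p a u f" and b: "uncond_expansion p b u f"
  shows "a = b"
proof
  fix j
  have "\<bar>a j - b j\<bar> * Lp_norm p (u j) \<le> 0"
  proof (rule field_le_epsilon)
    fix e :: real assume "0 < e"
    then have e: "0 < e / (2 * K)"
      using K by simp
    obtain A where A: "finite A" "\<And>F. finite F \<Longrightarrow> A \<subseteq> F \<Longrightarrow> Lp_norm p (\<lambda>x. f x - S F a x) < e / (2 * K)"
      using a e unfolding uncond_expansion_def by metis
    obtain B where B: "finite B" "\<And>F. finite F \<Longrightarrow> B \<subseteq> F \<Longrightarrow> Lp_norm p (\<lambda>x. f x - S F b x) < e / (2 * K)"
      using b e unfolding uncond_expansion_def by metis
    let ?F = "insert j (A \<union> B)"
    have "Lp_norm p (S ?F (\<lambda>j. a j - b j)) = Lp_norm p (\<lambda>x. S ?F a x - S ?F b x)"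
      by (simp add: left_diff_distrib sum_subtractf)
    also have "\<dots> \<le> Lp_norm p (\<lambda>x. S ?F a x - f x) + Lp_norm p (\<lambda>x. f x - S ?F b x)"
      by (intro Lp_norm_triangle_diff p in_Lp_S f)
    also have "\<dots> \<le> e / (2 * K) + e / (2 * K)"
      using A(2)[of ?F] B(2)[of ?F] A(1) B(1) by (subst Lp_norm_minus) (intro add_mono less_imp_le; auto)
    finally have "K * Lp_norm p (S ?F (\<lambda>j. a j - b j)) \<le> e"
      using K by (simp add: field_simps)
    then show "\<bar>a j - b j\<bar> * Lp_norm p (u j) \<le> 0 + e"
      using coeff_le[of ?F j "\<lambda>j. a j - b j"] A B by simp
  qed
  then show "a j = b j"
    using nonzero[of j] by (simp add: mult_le_0_iff)
qed

text \<open>Completeness of \<open>L\<^sup>p\<close> is not used: the limit \<open>f\<close> is given, and only its coefficients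
  have to be found as limits of the coefficients of approximants.\<close>

lemma expansion_exists:
  assumes "in_closed_span p u f"
  shows "\<exists>a. uncond_expansion p a u f"
proof -
  have f: "in_Lp p f"
    using assms by (simp add: in_closed_span_def)
  have "\<forall>n. \<exists>F a. finite F \<and> Lp_norm p (\<lambda>x. f x - S F a x) < inverse (real (Suc n))"
    using assms by (simp add: in_closed_span_def)
  then obtain F a' where F: "\<And>n. finite (F n)"
    and a': "\<And>n. Lp_norm p (\<lambda>x. f x - S (F n) (a' n) x) < inverse (real (Suc n))"
    by metis
  \<comment> \<open>Extension by 0 lets all approximants be summed over any common larger index
    set.\<close>
  define a where "a n j = (if j \<in> F n then a' n j else 0)" for n j
  have Sa: "S G (a n) = S (F n) (a' n)" if "finite G" "F n \<subseteq> G" for G n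
    using that F by (intro ext sum.mono_neutral_cong_right) (auto simp: a_def)
  \<comment> \<open>Over the union of the index sets both sums are near \<open>f\<close>;
    suppression carries this to an arbitrary finite \<open>G\<close>, with a bound independent of
    \<open>G\<close>.\<close>
  have close: "Lp_norm p (S G (\<lambda>j. a m j - a n j)) \<le> K * (inverse (real (Suc m)) + inverse (real (Suc n)))"
    if "finite G" for m n G
  proof -
    let ?G = "G \<union> F m \<union> F n"
    have "Lp_norm p (S G (\<lambda>j. a m j - a n j)) \<le> K * Lp_norm p (S ?G (\<lambda>j. a m j - a n j))"
      using F that by (intro suppression) auto
    also have "Lp_norm p (S ?G (\<lambda>j. a m j - a n j)) = Lp_norm p (\<lambda>x. S ?G (a m) x - S ?G (a n) x)"
      by (simp add: left_diff_distrib sum_subtractf)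
    also have "\<dots> = Lp_norm p (\<lambda>x. S (F m) (a' m) x - S (F n) (a' n) x)"
      using F that Sa[of ?G m] Sa[of ?G n] by (simp add: fun_eq_iff subset_iff)
    also have "\<dots> \<le> Lp_norm p (\<lambda>x. S (F m) (a' m) x - f x) + Lp_norm p (\<lambda>x. f x - S (F n) (a' n) x)"
      by (intro Lp_norm_triangle_diff p in_Lp_S f)
    also have "\<dots> \<le> inverse (real (Suc m)) + inverse (real (Suc n))"
      using a'[of m] a'[of n] by (subst Lp_norm_minus) linarith
    finally show ?thesis
      using K by simp
  qed
  have "Cauchy (\<lambda>n. a n j)" for j
  proof (rule metric_CauchyI)
    fix e :: real assume e: "0 < e"
    define d where "d = e * Lp_norm p (u j) / (2 * K)"
    have "0 < d" using e nonzero K by (simp add: d_def)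
    then obtain M where M: "inverse (real (Suc M)) < d"
      using reals_Archimedean by blast
    have "dist (a m j) (a n j) < e" if "m \<ge> M" "n \<ge> M" for m n
    proof -
      have "\<bar>a m j - a n j\<bar> * Lp_norm p (u j) \<le> K * (inverse (real (Suc m)) + inverse (real (Suc n)))"
        using close[of "{j}" m n] p by (simp add: Lp_norm_scale)
      also have "\<dots> \<le> K * (inverse (real (Suc M)) + inverse (real (Suc M)))"
        using that K by (intro mult_left_mono add_mono le_imp_inverse_le) auto
      also have "\<dots> < K * (d + d)"
        using M K by (intro mult_strict_left_mono add_strict_mono) auto
      also have "\<dots> = e * Lp_norm p (u j)"
        using K by (simp add: d_def)
      finally show ?thesis
        using nonzero[of j] by (simp add: dist_real_def)
    qed
    then show "\<exists>M. \<forall>m\<ge>M. \<forall>n\<ge>M. dist (a m j) (a n j) < e"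
      by blast
  qed
  moreover define b where "b j = lim (\<lambda>n. a n j)" for j
  ultimately have b: "(\<lambda>n. a n j) \<longlonglongrightarrow> b j" for j
    by (simp add: Cauchy_convergent flip: convergent_LIMSEQ_iff)
  \<comment> \<open>Let \<open>m\<close> tend to infinity in \<open>close\<close>: on a fixed finite
    \<open>G\<close>, convergence of the coefficients implies convergence in norm.\<close>
  have lim: "Lp_norm p (S G (\<lambda>j. a n j - b j)) \<le> K * inverse (real (Suc n))" if G: "finite G" for G n
  proof -
    have *: "Lp_norm p (S G (\<lambda>j. a n j - b j)) \<le> K * (inverse (real (Suc n)) + inverse (real (Suc m)))
        + (\<Sum>j\<in>G. \<bar>a m j - b j\<bar> * Lp_norm p (u j))" for m
    proof -
      have "Lp_norm p (S G (\<lambda>j. a n j - b j)) = Lp_norm p (\<lambda>x. S G (a n) x - S G b x)"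
        by (simp add: left_diff_distrib sum_subtractf)
      also have "\<dots> \<le> Lp_norm p (\<lambda>x. S G (a n) x - S G (a m) x) + Lp_norm p (\<lambda>x. S G (a m) x - S G b x)"
        by (intro Lp_norm_triangle_diff p in_Lp_S)
      also have "\<dots> = Lp_norm p (S G (\<lambda>j. a n j - a m j)) + Lp_norm p (S G (\<lambda>j. a m j - b j))"
        by (simp add: left_diff_distrib sum_subtractf)
      also have "\<dots> \<le> K * (inverse (real (Suc n)) + inverse (real (Suc m)))
          + (\<Sum>j\<in>G. \<bar>a m j - b j\<bar> * Lp_norm p (u j))"
        by (intro add_mono close G Lp_norm_sum_le p in_Lp)
      finally show ?thesis .
    qed
    have "(\<lambda>m. K * (inverse (real (Suc n)) + inverse (real (Suc m))) + (\<Sum>j\<in>G. \<bar>a m j - b j\<bar> * Lp_norm p (u j)))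
        \<longlonglongrightarrow> K * (inverse (real (Suc n)) + 0) + (\<Sum>j\<in>G. \<bar>b j - b j\<bar> * Lp_norm p (u j))"
      by (intro tendsto_intros b LIMSEQ_inverse_real_of_nat)
    from LIMSEQ_le_const[OF this] * show ?thesis
      by auto
  qed
  have "uncond_expansion p b u f"
    unfolding uncond_expansion_def
  proof (intro allI impI)
    fix e :: real assume "0 < e"
    \<comment> \<open>The approximant number \<open>n\<close> has error below
      \<open>inverse (Suc n)\<close>, and replacing its coefficients by \<open>b\<close> costs at
      most \<open>K\<close> times that amount.\<close>
    then obtain n where n: "inverse (real (Suc n)) < e / (1 + K)"
      using reals_Archimedean[of "e / (1 + K)"] K by auto
    have "Lp_norm p (\<lambda>x. f x - S G b x) < e" if G: "finite G" "F n \<subseteq> G" for G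
    proof -
      have "Lp_norm p (\<lambda>x. f x - S G b x)
          \<le> Lp_norm p (\<lambda>x. f x - S G (a n) x) + Lp_norm p (\<lambda>x. S G (a n) x - S G b x)"
        by (intro Lp_norm_triangle_diff p in_Lp_S f)
      also have "(\<lambda>x. S G (a n) x - S G b x) = S G (\<lambda>j. a n j - b j)"
        by (simp add: left_diff_distrib sum_subtractf)
      also have "Lp_norm p (\<lambda>x. f x - S G (a n) x) + Lp_norm p (S G (\<lambda>j. a n j - b j))
          \<le> inverse (real (Suc n)) + K * inverse (real (Suc n))"
        using a'[of n] Sa[OF G] lim[OF G(1), of n] by (auto simp: fun_eq_iff intro!: add_mono)
      also have "\<dots> = (1 + K) * inverse (real (Suc n))"
        by (simp add: algebra_simps)
      also have "\<dots> < e"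
        using n K by (simp add: pos_less_divide_eq mult.commute del: of_nat_Suc)
      finally show ?thesis .
    qed
    then show "\<exists>F0. finite F0 \<and> (\<forall>G. finite G \<and> F0 \<subseteq> G \<longrightarrow> Lp_norm p (\<lambda>x. f x - S G b x) < e)"
      using F by blast
  qed
  then show ?thesis by blast
qed

lemma uncond_basic: "uncond_basic_seq p u"
  unfolding uncond_basic_seq_def
  using in_Lp expansion_exists expansion_unique by (auto simp: in_closed_span_def)

end

section \<open>Khinchin's inequality for Rademacher sums\<close>

text \<open>The sign is read off the binary digit of \<open>x\<close> at place \<open>n + 1\<close>
  after the point. On the whole line the function has period 1, so integer translations leave it
  unchanged.\<close>

definition rad :: "nat \<Rightarrow> real \<Rightarrow> real" where
  "rad n x = (if even \<lfloor>2 ^ Suc n * x\<rfloor> then 1 else -1)"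

lemma rad_measurable [measurable]: "rad n \<in> borel_measurable borel"
proof -
  have "Measurable.pred (count_space UNIV) (\<lambda>k::int. even k)"
    by simp
  then show ?thesis
    unfolding rad_def by measurable
qed

lemma rad_add_int: "rad n (x + of_int k) = rad n x"
proof -
  have "2 ^ Suc n * (x + of_int k) = 2 ^ Suc n * x + of_int (2 ^ Suc n * k)"
    by (simp add: algebra_simps)
  then show ?thesis
    by (simp only: rad_def floor_add_int[symmetric]) simp
qed

lemma rad_Suc: "rad (Suc n) x = rad n (2 * x)"
  by (simp add: rad_def mult.assoc mult.left_commute)

lemma rad_0:
  shows "0 \<le> x \<Longrightarrow> x < 1 / 2 \<Longrightarrow> rad 0 x = 1"
    and "1 / 2 \<le> x \<Longrightarrow> x < 1 \<Longrightarrow> rad 0 x = -1"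
proof -
  show "rad 0 x = 1" if "0 \<le> x" "x < 1 / 2"
  proof -
    have "\<lfloor>2 * x\<rfloor> = 0" using that by linarith
    then show ?thesis by (simp add: rad_def)
  qed
  show "rad 0 x = -1" if "1 / 2 \<le> x" "x < 1"
  proof -
    have "\<lfloor>2 * x\<rfloor> = 1" using that by linarith
    then show ?thesis by (simp add: rad_def)
  qed
qed

definition rad_sum :: "nat \<Rightarrow> (nat \<Rightarrow> real) \<Rightarrow> real \<Rightarrow> real" where
  "rad_sum N b x = (\<Sum>n<N. b n * rad n x)"

lemma rad_sum_measurable [measurable]: "rad_sum N b \<in> borel_measurable borel"
  unfolding rad_sum_def by measurable

lemma rad_sum_add_int: "rad_sum N b (x + of_int k) = rad_sum N b x"
  by (simp add: rad_sum_def rad_add_int)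

lemma rad_sum_Suc: "rad_sum (Suc N) b x = b 0 * rad 0 x + rad_sum N (b \<circ> Suc) (2 * x)"
  by (simp add: rad_sum_def sum.lessThan_Suc_shift rad_Suc del: sum.lessThan_Suc)

lemma rad_sum_scale: "rad_sum N (\<lambda>n. c * b n) x = c * rad_sum N b x"
  by (simp add: rad_sum_def sum_distrib_left mult.assoc)

text \<open>Halving, \<open>x = y / 2\<close>, splits off the first sign: it is constant on each
  half of the unit interval, while the remaining sum runs through a full period. This takes the
  place of independence in the moment computations.\<close>

lemma nn_integral_rad_sum_Suc:
  fixes \<Phi> :: "real \<Rightarrow> ennreal"
  assumes [measurable]: "\<Phi> \<in> borel_measurable borel"
  shows "(\<integral>\<^sup>+x\<in>{0..<1}. \<Phi> (rad_sum (Suc N) b x) \<partial>lborel) =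
    ennreal (1 / 2) * ((\<integral>\<^sup>+x\<in>{0..<1}. \<Phi> (b 0 + rad_sum N (b \<circ> Suc) x) \<partial>lborel) +
      (\<integral>\<^sup>+x\<in>{0..<1}. \<Phi> (- b 0 + rad_sum N (b \<circ> Suc) x) \<partial>lborel))"
proof -
  let ?S = "rad_sum N (b \<circ> Suc)"
  have "(\<integral>\<^sup>+x\<in>{0..<1}. \<Phi> (rad_sum (Suc N) b x) \<partial>lborel) =
      ennreal (1 / 2) * (\<integral>\<^sup>+y. \<Phi> (b 0 * rad 0 (y / 2) + ?S y) * indicator {0..<1} (y / 2) \<partial>lborel)"
    by (subst nn_integral_real_affine[where c = "1 / 2" and t = 0]) (simp_all add: rad_sum_Suc)
  also have "(\<integral>\<^sup>+y. \<Phi> (b 0 * rad 0 (y / 2) + ?S y) * indicator {0..<1} (y / 2) \<partial>lborel)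
      = (\<integral>\<^sup>+y. \<Phi> (b 0 + ?S y) * indicator {0..<1} y + \<Phi> (- b 0 + ?S y) * indicator {1..<2} y \<partial>lborel)"
    by (intro nn_integral_cong) (auto simp: indicator_def rad_0)
  also have "\<dots> = (\<integral>\<^sup>+y\<in>{0..<1}. \<Phi> (b 0 + ?S y) \<partial>lborel) + (\<integral>\<^sup>+y\<in>{1..<2}. \<Phi> (- b 0 + ?S y) \<partial>lborel)"
    by (intro nn_integral_add) measurable
  also have "(\<integral>\<^sup>+y\<in>{1..<2}. \<Phi> (- b 0 + ?S y) \<partial>lborel) = (\<integral>\<^sup>+y\<in>{0..<1}. \<Phi> (- b 0 + ?S y) \<partial>lborel)"
  proof -
    have "?S (1 + y) = ?S y" for y
      using rad_sum_add_int[of N "b \<circ> Suc" y 1] by (simp add: add.commute)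
    then show ?thesis
      by (subst nn_integral_real_affine[where c = 1 and t = 1])
        (auto intro!: nn_integral_cong simp: indicator_def)
  qed
  finally show ?thesis .
qed

section \<open>Exponential and second moments of Rademacher sums\<close>

lemma ennreal_half_sum:
  fixes x y :: real
  assumes "0 \<le> x" "0 \<le> y"
  shows "ennreal (1 / 2) * (ennreal x + ennreal y) = ennreal ((x + y) / 2)"
proof -
  have "ennreal (1 / 2) * (ennreal x + ennreal y) = ennreal (1 / 2 * (x + y))"
    using assms by (subst ennreal_mult) auto
  then show ?thesis by simp
qed

text \<open>The constant \<open>c\<close> carries the induction: each halving moves
  \<open>b 0\<close> or \<open>- b 0\<close> into it, and the two exponentials average to
  \<open>exp c * cosh (b 0)\<close>.\<close>

lemma nn_integral_exp_rad_sum: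
  "(\<integral>\<^sup>+x\<in>{0..<1}. ennreal (exp (c + rad_sum N b x)) \<partial>lborel) = ennreal (exp c * (\<Prod>n<N. cosh (b n)))"
proof (induction N arbitrary: b c)
  case 0
  then show ?case
    by (simp add: rad_sum_def nn_integral_cmult)
next
  case (Suc N)
  have "(\<integral>\<^sup>+x\<in>{0..<1}. ennreal (exp (c + rad_sum (Suc N) b x)) \<partial>lborel) =
    ennreal (1 / 2) * ((\<integral>\<^sup>+x\<in>{0..<1}. ennreal (exp (c + b 0 + rad_sum N (b \<circ> Suc) x)) \<partial>lborel) +
      (\<integral>\<^sup>+x\<in>{0..<1}. ennreal (exp (c + - b 0 + rad_sum N (b \<circ> Suc) x)) \<partial>lborel))"
    by (subst nn_integral_rad_sum_Suc[where \<Phi> = "\<lambda>y. ennreal (exp (c + y))"])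
      (simp_all only: add.assoc, measurable)
  also have "\<dots> = ennreal ((exp (c + b 0) * (\<Prod>n<N. cosh (b (Suc n))) + exp (c + - b 0) * (\<Prod>n<N. cosh (b (Suc n)))) / 2)"
    unfolding Suc.IH by (subst ennreal_half_sum) (auto intro!: mult_nonneg_nonneg prod_nonneg)
  also have "(exp (c + b 0) * (\<Prod>n<N. cosh (b (Suc n))) + exp (c + - b 0) * (\<Prod>n<N. cosh (b (Suc n)))) / 2
      = exp c * (\<Prod>n<Suc N. cosh (b n))"
  proof -
    have *: "(e * v * P + e * w * P) / 2 = e * ((v + w) / 2 * P)" for e v w P :: real
      by (simp add: distrib_left distrib_right)
    show ?thesis
      unfolding exp_add prod.lessThan_Suc_shift cosh_field_def[of "b 0"] by (rule *)
  qed
  finally show ?case .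
qed

text \<open>Same induction as for the exponential moment; averaging over the two signs cancels the
  cross term \<open>2 * c * b 0\<close>.\<close>

lemma nn_integral_power2_rad_sum:
  "(\<integral>\<^sup>+x\<in>{0..<1}. ennreal ((c + rad_sum N b x)\<^sup>2) \<partial>lborel) = ennreal (c\<^sup>2 + (\<Sum>n<N. (b n)\<^sup>2))"
proof (induction N arbitrary: b c)
  case 0
  then show ?case
    by (simp add: rad_sum_def nn_integral_cmult)
next
  case (Suc N)
  have "(\<integral>\<^sup>+x\<in>{0..<1}. ennreal ((c + rad_sum (Suc N) b x)\<^sup>2) \<partial>lborel) =
    ennreal (1 / 2) * ((\<integral>\<^sup>+x\<in>{0..<1}. ennreal ((c + b 0 + rad_sum N (b \<circ> Suc) x)\<^sup>2) \<partial>lborel) +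
      (\<integral>\<^sup>+x\<in>{0..<1}. ennreal ((c + - b 0 + rad_sum N (b \<circ> Suc) x)\<^sup>2) \<partial>lborel))"
    by (subst nn_integral_rad_sum_Suc[where \<Phi> = "\<lambda>y. ennreal ((c + y)\<^sup>2)"])
      (simp_all only: add.assoc, measurable)
  also have "\<dots> = ennreal (((c + b 0)\<^sup>2 + (\<Sum>n<N. (b (Suc n))\<^sup>2) + ((c + - b 0)\<^sup>2 + (\<Sum>n<N. (b (Suc n))\<^sup>2))) / 2)"
    unfolding Suc.IH by (subst ennreal_half_sum) (auto intro!: add_nonneg_nonneg sum_nonneg)
  also have "((c + b 0)\<^sup>2 + (\<Sum>n<N. (b (Suc n))\<^sup>2) + ((c + - b 0)\<^sup>2 + (\<Sum>n<N. (b (Suc n))\<^sup>2))) / 2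
      = c\<^sup>2 + (\<Sum>n<Suc N. (b n)\<^sup>2)"
    by (simp add: sum.lessThan_Suc_shift power2_eq_square algebra_simps del: sum.lessThan_Suc)
  finally show ?case .
qed

text \<open>Termwise comparison of the power series, resting on
  \<open>2 ^ n * fact n \<le> fact (2 * n)\<close>.\<close>

lemma cosh_le_exp_half_square: "cosh x \<le> exp (x\<^sup>2 / 2)" for x :: real
proof (rule sums_le)
  define f where "f n = (if even n then x ^ n /\<^sub>R fact n else 0)" for n
  have "(\<lambda>n. f (2 * n)) sums cosh x"
  proof (rule sums_mono_reindex[THEN iffD2])
    show "strict_mono (\<lambda>n::nat. 2 * n)"
      by (simp add: strict_mono_def)
    show "f n = 0" if "n \<notin> range (\<lambda>n. 2 * n)" for n
      using that by (auto simp: f_def elim!: evenE)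
    show "f sums cosh x"
      unfolding f_def by (rule cosh_converges)
  qed
  moreover have "f (2 * n) = x ^ (2 * n) / fact (2 * n)" for n
    by (simp add: f_def divide_real_def mult.commute)
  ultimately show "(\<lambda>n. x ^ (2 * n) / fact (2 * n)) sums cosh x"
    by (simp only:)
  show "(\<lambda>n. (x\<^sup>2 / 2) ^ n / fact n) sums exp (x\<^sup>2 / 2)"
    using exp_converges[of "x\<^sup>2 / 2"] by (simp only: real_scaleR_def divide_inverse_commute)
  have fact: "2 ^ n * fact n \<le> (fact (2 * n) :: real)" for n
  proof (induction n)
    case (Suc n)
    have "2 ^ Suc n * fact (Suc n) = (2 * (real n + 1)) * (2 ^ n * fact n :: real)"
      by (simp add: algebra_simps)
    also have "\<dots> \<le> (2 * (real n + 1)) * ((2 * real n + 1) * fact (2 * n))"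
    proof (rule mult_left_mono)
      have "1 * (2 ^ n * fact n) \<le> (2 * real n + 1) * fact (2 * n)"
        by (rule mult_mono[OF _ Suc.IH]) simp_all
      then show "2 ^ n * fact n \<le> (2 * real n + 1) * fact (2 * n)"
        by simp
    qed simp
    also have "\<dots> = fact (Suc (Suc (2 * n)))"
      by (simp add: algebra_simps)
    finally show ?case
      by simp
  qed simp
  fix n
  have "x ^ (2 * n) / fact (2 * n) \<le> x ^ (2 * n) / (2 ^ n * fact n)"
    using fact[of n] by (intro divide_left_mono) (auto simp: power_mult)
  then show "x ^ (2 * n) / fact (2 * n) \<le> (x\<^sup>2 / 2) ^ n / fact n"
    by (simp only: power_divide power_mult divide_divide_eq_left)
qed

text \<open>The factor 2 counts two exponential moments, \<open>p powr p\<close> comes from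
  \<open>abs_powr_le_exp\<close>, and \<open>exp (1 / 2)\<close> bounds the product of the
  \<open>cosh (b n)\<close> when the squares of the \<open>b n\<close> add up to 1.\<close>

definition khinchin_const :: "real \<Rightarrow> real" where
  "khinchin_const p = 2 * p powr p * exp (1 / 2)"

text \<open>Raise \<open>z \<le> exp z\<close> at \<open>z = \<bar>y\<bar> / p\<close> to the power
  \<open>p\<close>.\<close>

lemma abs_powr_le_exp:
  fixes p y :: real
  assumes "0 < p"
  shows "\<bar>y\<bar> powr p \<le> p powr p * (exp y + exp (- y))"
proof -
  have "\<bar>y\<bar> / p \<le> exp (\<bar>y\<bar> / p)"
    using exp_ge_add_one_self[of "\<bar>y\<bar> / p"] by linarith
  then have "\<bar>y\<bar> powr p \<le> (p * exp (\<bar>y\<bar> / p)) powr p"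
    using assms by (intro powr_mono2) (auto simp: field_simps)
  also have "\<dots> = p powr p * exp \<bar>y\<bar>"
    using assms by (simp add: powr_mult exp_powr_real)
  also have "\<dots> \<le> p powr p * (exp y + exp (- y))"
    by (intro mult_left_mono) (auto simp: abs_if)
  finally show ?thesis .
qed

text \<open>The power is dominated by exponentials of both signs, and their moments are controlled
  by \<open>cosh_le_exp_half_square\<close>.\<close>

lemma khinchin_upper_normalized:
  assumes p: "0 < p" and b: "(\<Sum>n<N. (b n)\<^sup>2) = 1"
  shows "(\<integral>\<^sup>+x\<in>{0..<1}. ennreal (\<bar>rad_sum N b x\<bar> powr p) \<partial>lborel) \<le> ennreal (khinchin_const p)"
proof -
  have cosh: "(\<Prod>n<N. cosh (b n)) \<le> exp (1 / 2)"
  proof -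
    have "(\<Prod>n<N. cosh (b n)) \<le> (\<Prod>n<N. exp ((b n)\<^sup>2 / 2))"
      by (intro prod_mono) (auto simp: cosh_le_exp_half_square)
    also have "\<dots> = exp ((\<Sum>n<N. (b n)\<^sup>2) / 2)"
      by (simp add: exp_sum sum_divide_distrib)
    also have "\<dots> = exp (1 / 2)"
      by (simp add: b)
    finally show ?thesis .
  qed
  have neg: "- rad_sum N b x = rad_sum N (\<lambda>n. - b n) x" for x
    by (simp add: rad_sum_def sum_negf)
  have exp: "\<bar>rad_sum N b x\<bar> powr p \<le> p powr p * (exp (rad_sum N b x) + exp (rad_sum N (\<lambda>n. - b n) x))" for x
    using abs_powr_le_exp[OF p, of "rad_sum N b x"] by (simp add: neg)
  have "(\<integral>\<^sup>+x\<in>{0..<1}. ennreal (\<bar>rad_sum N b x\<bar> powr p) \<partial>lborel) \<le>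
    (\<integral>\<^sup>+x. ennreal (p powr p) * (ennreal (exp (0 + rad_sum N b x)) * indicator {0..<1} x +
      ennreal (exp (0 + rad_sum N (\<lambda>n. - b n) x)) * indicator {0..<1} x) \<partial>lborel)"
    using exp
    by (intro nn_integral_mono) (auto simp: indicator_def simp flip: ennreal_plus ennreal_mult)
  also have "\<dots> = ennreal (p powr p) * ((\<integral>\<^sup>+x\<in>{0..<1}. ennreal (exp (0 + rad_sum N b x)) \<partial>lborel) +
      (\<integral>\<^sup>+x\<in>{0..<1}. ennreal (exp (0 + rad_sum N (\<lambda>n. - b n) x)) \<partial>lborel))"
    by (simp add: nn_integral_cmult nn_integral_add)
  also have "\<dots> = ennreal (p powr p * (2 * (\<Prod>n<N. cosh (b n))))"
  proof -
    have P: "0 \<le> (\<Prod>n<N. cosh (b n))"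
      by (simp add: prod_nonneg)
    then show ?thesis
      unfolding nn_integral_exp_rad_sum cosh_minus exp_zero mult_1 mult_2
      by (subst ennreal_mult, simp, simp, subst ennreal_plus) simp_all
  qed
  also have "\<dots> \<le> ennreal (khinchin_const p)"
    unfolding khinchin_const_def using mult_left_mono[OF cosh, of "p powr p * 2"]
    by (intro ennreal_leI) (simp add: mult_ac)
  finally show ?thesis .
qed

text \<open>The second moment is 1, so it suffices to integrate the tangent bound
  \<open>q * t \<le> t powr q + (q - 1)\<close> at \<open>t = y\<^sup>2\<close>.\<close>

lemma khinchin_lower_normalized:
  assumes p: "2 < p" and b: "(\<Sum>n<N. (b n)\<^sup>2) = 1"
  shows "1 \<le> (\<integral>\<^sup>+x\<in>{0..<1}. ennreal (\<bar>rad_sum N b x\<bar> powr p) \<partial>lborel)"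
proof -
  define q where "q = p / 2"
  have q: "1 < q" using p by (simp add: q_def)
  have young: "q * y\<^sup>2 \<le> \<bar>y\<bar> powr p + (q - 1)" for y :: real
  proof -
    \<comment> \<open>Young's inequality with second factor 1 is the tangent bound;
      \<open>q / (q - 1)\<close> is the exponent conjugate to \<open>q\<close>.\<close>
    have "y\<^sup>2 * 1 \<le> y\<^sup>2 powr q / q + 1 powr (q / (q - 1)) / (q / (q - 1))"
      using q by (intro Youngs_inequality) (auto simp: field_simps)
    then have "q * (y\<^sup>2 * 1) \<le> q * (y\<^sup>2 powr q / q + 1 powr (q / (q - 1)) / (q / (q - 1)))"
      using q by (intro mult_left_mono) auto
    also have "\<dots> = y\<^sup>2 powr q + (q - 1)"
      using q by (simp add: distrib_left)
    moreover have "y\<^sup>2 powr q = \<bar>y\<bar> powr p"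
      using powr_powr[of "\<bar>y\<bar>" 2 q] by (cases "y = 0") (auto simp: q_def)
    ultimately show ?thesis
      by simp
  qed
  have "ennreal q = ennreal q * (\<integral>\<^sup>+x\<in>{0..<1}. ennreal ((0 + rad_sum N b x)\<^sup>2) \<partial>lborel)"
    unfolding nn_integral_power2_rad_sum using b by simp
  also have "\<dots> = (\<integral>\<^sup>+x. ennreal q * (ennreal ((0 + rad_sum N b x)\<^sup>2) * indicator {0..<1} x) \<partial>lborel)"
    by (rule nn_integral_cmult[symmetric]) measurable
  also have "\<dots> \<le> (\<integral>\<^sup>+x. ennreal (\<bar>rad_sum N b x\<bar> powr p) * indicator {0..<1} x
      + ennreal (q - 1) * indicator {0..<1} x \<partial>lborel)"
    using young q by (intro nn_integral_mono) (auto simp: indicator_def simp flip: ennreal_plus ennreal_mult)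
  also have "\<dots> = (\<integral>\<^sup>+x\<in>{0..<1}. ennreal (\<bar>rad_sum N b x\<bar> powr p) \<partial>lborel) + ennreal (q - 1)"
    by (subst nn_integral_add, measurable) (simp add: nn_integral_cmult)
  finally have *: "ennreal q \<le> (\<integral>\<^sup>+x\<in>{0..<1}. ennreal (\<bar>rad_sum N b x\<bar> powr p) \<partial>lborel) + ennreal (q - 1)" .
  have "ennreal q = 1 + ennreal (q - 1)"
    using q by (simp flip: ennreal_1 ennreal_plus)
  with * show ?thesis
    by simp
qed

text \<open>All terms are homogeneous of degree \<open>p\<close> in \<open>b\<close>, so division by
  \<open>s\<close> reduces to the normalized case; for \<open>s = 0\<close> all coefficients
  vanish.\<close>

lemma khinchin:
  assumes p: "2 < p"
  shows "ennreal ((\<Sum>n<N. (b n)\<^sup>2) powr (p / 2)) \<le> (\<integral>\<^sup>+x\<in>{0..<1}. ennreal (\<bar>rad_sum N b x\<bar> powr p) \<partial>lborel)" (is ?L)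
    and "(\<integral>\<^sup>+x\<in>{0..<1}. ennreal (\<bar>rad_sum N b x\<bar> powr p) \<partial>lborel)
      \<le> ennreal (khinchin_const p * (\<Sum>n<N. (b n)\<^sup>2) powr (p / 2))" (is ?U)
proof -
  define s where "s = sqrt (\<Sum>n<N. (b n)\<^sup>2)"
  have s2: "s\<^sup>2 = (\<Sum>n<N. (b n)\<^sup>2)"
    by (simp add: s_def sum_nonneg)
  have "0 \<le> s"
    by (simp add: s_def sum_nonneg)
  have sp: "(\<Sum>n<N. (b n)\<^sup>2) powr (p / 2) = s powr p"
    using powr_powr[of s 2 "p / 2"] \<open>0 \<le> s\<close> by (cases "s = 0") (auto simp flip: s2)
  have "?L \<and> ?U"
  proof (cases "s = 0")
    case True
    then have "\<forall>n<N. b n = 0"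
      using s2 by (simp add: sum_nonneg_eq_0_iff)
    then have "rad_sum N b x = 0" for x
      by (simp add: rad_sum_def)
    then show ?thesis
      using sp True by simp
  next
    case False
    define c where "c n = b n / s" for n
    have "(\<Sum>n<N. (c n)\<^sup>2) = 1"
      unfolding c_def power_divide sum_divide_distrib[symmetric] s2[symmetric] using False by simp
    note c = khinchin_lower_normalized[OF p this] khinchin_upper_normalized[of p, OF _ this]
    have "rad_sum N b x = s * rad_sum N c x" for x
      using False by (simp add: c_def flip: rad_sum_scale)
    then have "(\<integral>\<^sup>+x\<in>{0..<1}. ennreal (\<bar>rad_sum N b x\<bar> powr p) \<partial>lborel)
        = (\<integral>\<^sup>+x. ennreal (s powr p) * (ennreal (\<bar>rad_sum N c x\<bar> powr p) * indicator {0..<1} x) \<partial>lborel)"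
      using \<open>0 \<le> s\<close> by (intro nn_integral_cong) (auto simp: abs_mult powr_mult ennreal_mult mult.assoc)
    also have "\<dots> = ennreal (s powr p) * (\<integral>\<^sup>+x\<in>{0..<1}. ennreal (\<bar>rad_sum N c x\<bar> powr p) \<partial>lborel)"
      by (rule nn_integral_cmult) measurable
    finally show ?thesis
      unfolding sp using c p mult_left_mono[OF c(1), of "ennreal (s powr p)"]
        mult_left_mono[OF c(2), of "ennreal (s powr p)"]
      by (simp add: ennreal_mult mult.commute khinchin_const_def)
  qed
  then show ?L ?U by auto
qed

section \<open>The translates and their square functions\<close>

definition gen :: "real \<Rightarrow> real" where
  "gen x = (if x < 0 then 0 else rad (nat \<lfloor>x\<rfloor>) x / sqrt (real (Suc (nat \<lfloor>x\<rfloor>))))"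

text \<open>The point \<open>x - real (Suc j)\<close> lies in \<open>[m - j - 1, m - j)\<close>, for
  \<open>j < m\<close> the piece of \<open>gen\<close> with index \<open>m - Suc j\<close>;
  periodicity then moves the Rademacher function back to \<open>x\<close>. Different
  \<open>j < m\<close> give different Rademacher functions.\<close>

lemma gen_window:
  assumes "x \<in> {real m..<real m + 1}"
  shows "gen (x - real (Suc j)) = (if j < m then rad (m - Suc j) x / sqrt (real (m - j)) else 0)"
proof (cases "j < m")
  case True
  have "\<lfloor>x - real (Suc j)\<rfloor> = int (m - Suc j)"
    using assms True by (subst floor_eq_iff) (auto simp: of_nat_diff)
  then have "nat \<lfloor>x - real (Suc j)\<rfloor> = m - Suc j"
    by (simp only: nat_int)
  moreover have "\<not> x - real (Suc j) < 0"
    using assms True by auto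
  moreover have "rad k (x - real (Suc j)) = rad k x" for k
    using rad_add_int[of k "x - real (Suc j)" "int (Suc j)"] by simp
  ultimately show ?thesis
    using True by (simp add: gen_def Suc_diff_Suc del: of_nat_Suc of_nat_diff)
next
  case False
  then show ?thesis
    using assms by (auto simp: gen_def)
qed

lemma gen_measurable [measurable]: "gen \<in> borel_measurable borel"
proof -
  have "(\<lambda>x. rad (nat \<lfloor>x\<rfloor>) x) \<in> borel_measurable borel"
    by (rule measurable_compose_countable[where f = rad]) measurable
  then show ?thesis
    unfolding gen_def[abs_def] by measurable
qed

definition translate_sum :: "nat set \<Rightarrow> (nat \<Rightarrow> real) \<Rightarrow> real \<Rightarrow> real" where
  "translate_sum F a x = (\<Sum>j\<in>F. a j * gen (x - real (Suc j)))"

lemma translate_sum_measurable [measurable]: "translate_sum F a \<in> borel_measurable borel"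
  unfolding translate_sum_def by measurable

text \<open>The squared square function of \<open>translate_sum F a\<close> on the window \<open>[m, m + 1)\<close>. Terms
  with \<open>j \<ge> m\<close> vanish, since the truncated difference is \<open>0\<close> and \<open>z / 0 = 0\<close>.\<close>

definition sq_fun :: "nat set \<Rightarrow> (nat \<Rightarrow> real) \<Rightarrow> nat \<Rightarrow> real" where
  "sq_fun F a m = (\<Sum>j\<in>F. (a j)\<^sup>2 / real (m - j))"

lemma sq_fun_nonneg [simp]: "0 \<le> sq_fun F a m"
  by (simp add: sq_fun_def sum_nonneg)

lemma sq_fun_mono: "finite F \<Longrightarrow> G \<subseteq> F \<Longrightarrow> sq_fun G a m \<le> sq_fun F a m"
  unfolding sq_fun_def by (intro sum_mono2) auto

text \<open>On the window the sum is a Rademacher sum, to which Khinchin's inequality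
  applies.\<close>

lemma nn_integral_window:
  assumes p: "2 < p" and F: "finite F"
  shows "ennreal (sq_fun F a m powr (p / 2))
      \<le> (\<integral>\<^sup>+x\<in>{real m..<real m + 1}. ennreal (\<bar>translate_sum F a x\<bar> powr p) \<partial>lborel)" (is ?L)
    and "(\<integral>\<^sup>+x\<in>{real m..<real m + 1}. ennreal (\<bar>translate_sum F a x\<bar> powr p) \<partial>lborel)
      \<le> ennreal (khinchin_const p * sq_fun F a m powr (p / 2))" (is ?U)
proof -
  \<comment> \<open>Reindexing by \<open>n = m - Suc j\<close>: for \<open>n < m\<close>,
    \<open>b n\<close> is the coefficient of \<open>rad n\<close> on the window.\<close>
  define b where "b n = (if m - Suc n \<in> F then a (m - Suc n) / sqrt (real (Suc n)) else 0)" for n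
  have b: "b (m - Suc j) = (if j \<in> F then a j / sqrt (real (m - j)) else 0)" if "j < m" for j
    using that by (simp add: b_def Suc_diff_Suc)
  have "(\<Sum>n<m. (b n)\<^sup>2) = (\<Sum>j<m. (b (m - Suc j))\<^sup>2)"
    by (rule sum.nat_diff_reindex[symmetric])
  also have "\<dots> = sq_fun F a m"
    unfolding sq_fun_def using F
    by (intro sum.mono_neutral_cong) (auto simp: b power_divide)
  finally have sq: "sq_fun F a m = (\<Sum>n<m. (b n)\<^sup>2)" by simp
  have rad: "translate_sum F a (real m + x) = rad_sum m b x" if "x \<in> {0..<1}" for x
  proof -
    have gen: "gen (real m + x - real (Suc j))
        = (if j < m then rad (m - Suc j) (real m + x) / sqrt (real (m - j)) else 0)" for j
      using that by (intro gen_window) auto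
    have "rad_sum m b x = rad_sum m b (real m + x)"
      using rad_sum_add_int[of m b x "int m"] by (simp add: add.commute)
    also have "\<dots> = (\<Sum>j<m. b (m - Suc j) * rad (m - Suc j) (real m + x))"
      unfolding rad_sum_def by (rule sum.nat_diff_reindex[symmetric])
    also have "\<dots> = translate_sum F a (real m + x)"
      unfolding translate_sum_def gen using F
      by (intro sum.mono_neutral_cong) (auto simp: b simp del: of_nat_diff)
    finally show ?thesis by simp
  qed
  have "(\<integral>\<^sup>+x\<in>{real m..<real m + 1}. ennreal (\<bar>translate_sum F a x\<bar> powr p) \<partial>lborel)
      = (\<integral>\<^sup>+x\<in>{0..<1}. ennreal (\<bar>rad_sum m b x\<bar> powr p) \<partial>lborel)"
    by (subst nn_integral_real_affine[where c = 1 and t = "real m"])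
      (auto intro!: nn_integral_cong simp: indicator_def rad)
  then show ?L ?U
    unfolding sq using khinchin[OF p, where b = b and N = m] by simp_all
qed

lemma nn_integral_windows:
  fixes f :: "real \<Rightarrow> ennreal"
  assumes [measurable]: "f \<in> borel_measurable borel" and f: "\<And>x. x < 0 \<Longrightarrow> f x = 0"
  shows "(\<integral>\<^sup>+x. f x \<partial>lborel) = (\<Sum>m. \<integral>\<^sup>+x\<in>{real m..<real m + 1}. f x \<partial>lborel)"
proof -
  have disj: "disjoint_family (\<lambda>m. {real m..<real m + 1})"
    by (auto simp: disjoint_family_on_def)
  have "(\<integral>\<^sup>+x. f x \<partial>lborel) = (\<integral>\<^sup>+x. (\<Sum>m. f x * indicator {real m..<real m + 1} x) \<partial>lborel)"
  proof (intro nn_integral_cong)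
    fix x :: real
    show "f x = (\<Sum>m. f x * indicator {real m..<real m + 1} x)"
    proof (cases "x < 0")
      case False
      then have "x \<in> {real (nat \<lfloor>x\<rfloor>)..<real (nat \<lfloor>x\<rfloor>) + 1}"
        by auto
      from suminf_cmult_indicator[OF disj this, of "\<lambda>_. f x"] show ?thesis
        by simp
    qed (simp add: f)
  qed
  also have "\<dots> = (\<Sum>m. \<integral>\<^sup>+x\<in>{real m..<real m + 1}. f x \<partial>lborel)"
    by (rule nn_integral_suminf) measurable
  finally show ?thesis .
qed

text \<open>On each window the modulus is constant, and the values
  \<open>real (Suc m) powr - (p / 2)\<close> are summable because \<open>p > 2\<close>.\<close>

lemma gen_in_Lp:
  assumes p: "2 < p"
  shows "in_Lp p gen"
proof -
  have "(\<integral>\<^sup>+x. ennreal (\<bar>gen x\<bar> powr p) \<partial>lborel)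
      = (\<Sum>m. \<integral>\<^sup>+x\<in>{real m..<real m + 1}. ennreal (\<bar>gen x\<bar> powr p) \<partial>lborel)"
    by (intro nn_integral_windows) (auto simp: gen_def)
  also have "\<dots> = (\<Sum>m. ennreal (real (Suc m) powr - (p / 2)))"
  proof (intro suminf_cong)
    fix m
    have "\<bar>gen x\<bar> powr p = real (Suc m) powr - (p / 2)" if "x \<in> {real m..<real m + 1}" for x
    proof -
      have "\<lfloor>x\<rfloor> = int m"
        using that by (subst floor_eq_iff) auto
      then have "\<bar>gen x\<bar> = 1 / sqrt (real (Suc m))"
        using that by (auto simp: gen_def rad_def)
      then show ?thesis
        by (simp add: powr_divide powr_powr powr_minus_divide flip: powr_half_sqrt)
    qed
    then have "(\<integral>\<^sup>+x\<in>{real m..<real m + 1}. ennreal (\<bar>gen x\<bar> powr p) \<partial>lborel)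
        = (\<integral>\<^sup>+x\<in>{real m..<real m + 1}. ennreal (real (Suc m) powr - (p / 2)) \<partial>lborel)"
      by (intro nn_integral_cong) (auto simp: indicator_def)
    then show "(\<integral>\<^sup>+x\<in>{real m..<real m + 1}. ennreal (\<bar>gen x\<bar> powr p) \<partial>lborel)
        = ennreal (real (Suc m) powr - (p / 2))"
      by (simp add: nn_integral_cmult)
  qed
  also have "\<dots> < \<infinity>"
  proof -
    have "summable (\<lambda>m. real (Suc m) powr - (p / 2))"
      using p by (subst summable_Suc_iff) (simp add: summable_real_powr_iff)
    then have "(\<Sum>m. ennreal (real (Suc m) powr - (p / 2))) \<noteq> top"
      by (rule ennreal_suminf_neq_top) simp
    then show ?thesis
      by (simp add: top.not_eq_extremum)
  qed
  finally show ?thesis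
    by (auto simp: in_Lp_def integrable_iff_bounded)
qed

lemma in_Lp_translate:
  assumes "in_Lp p f"
  shows "in_Lp p (\<lambda>x. f (x - c))"
  using assms lborel_integrable_real_affine[of "\<lambda>x. \<bar>f x\<bar> powr p" 1 "- c"]
  by (auto simp: in_Lp_def)

lemma translate_sum_in_Lp:
  assumes "2 < p"
  shows "in_Lp p (translate_sum F a)"
  unfolding translate_sum_def[abs_def] using assms
  by (intro in_Lp_sum in_Lp_translate gen_in_Lp) auto

section \<open>Norms of sums of translates as sums over windows\<close>

definition window_sum :: "real \<Rightarrow> nat set \<Rightarrow> (nat \<Rightarrow> real) \<Rightarrow> real" where
  "window_sum p F a = (\<Sum>m. sq_fun F a m powr (p / 2))"

text \<open>The window estimates are added over \<open>m\<close>. Finiteness of the norm and the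
  lower estimates give summability first, which allows passing from extended to real series.\<close>

lemma window_sum_estimate:
  assumes p: "2 < p" and F: "finite F"
  shows summable_window: "summable (\<lambda>m. sq_fun F a m powr (p / 2))"
    and window_sum_le: "window_sum p F a \<le> Lp_norm p (translate_sum F a) powr p"
    and window_sum_ge: "Lp_norm p (translate_sum F a) powr p \<le> khinchin_const p * window_sum p F a"
proof -
  let ?I = "Lp_norm p (translate_sum F a) powr p"
  have "ennreal ?I = (\<integral>\<^sup>+x. ennreal (\<bar>translate_sum F a x\<bar> powr p) \<partial>lborel)"
    using p by (simp add: Lp_norm_powr nn_integral_eq_integral in_Lp_integrable translate_sum_in_Lp)
  also have "\<dots> = (\<Sum>m. \<integral>\<^sup>+x\<in>{real m..<real m + 1}. ennreal (\<bar>translate_sum F a x\<bar> powr p) \<partial>lborel)"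
    by (intro nn_integral_windows) (auto simp: translate_sum_def gen_def)
  finally have I: "ennreal ?I = \<dots>" .
  have low: "(\<Sum>m. ennreal (sq_fun F a m powr (p / 2))) \<le> ennreal ?I"
    unfolding I by (intro suminf_le nn_integral_window p F) auto
  then have "(\<Sum>m. ennreal (sq_fun F a m powr (p / 2))) \<noteq> top"
    by (metis ennreal_neq_top top.extremum_unique)
  then show sum: "summable (\<lambda>m. sq_fun F a m powr (p / 2))"
    by (intro summable_suminf_not_top) auto
  have eq: "(\<Sum>m. ennreal (sq_fun F a m powr (p / 2))) = ennreal (window_sum p F a)"
    unfolding window_sum_def by (intro suminf_ennreal_eq summable_sums sum) auto
  show "window_sum p F a \<le> ?I"
    using low unfolding eq by simp
  have "ennreal ?I \<le> (\<Sum>m. ennreal (khinchin_const p * sq_fun F a m powr (p / 2)))"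
    unfolding I by (intro suminf_le nn_integral_window p F) auto
  also have "\<dots> = ennreal (khinchin_const p * window_sum p F a)"
    unfolding window_sum_def
    by (intro suminf_ennreal_eq sums_mult summable_sums sum) (auto simp: khinchin_const_def)
  finally show "?I \<le> khinchin_const p * window_sum p F a"
    by (subst (asm) ennreal_le_iff)
      (auto simp: khinchin_const_def window_sum_def intro!: mult_nonneg_nonneg suminf_nonneg sum)
qed

text \<open>\<open>sq_fun\<close> grows with the index set; passing from the norm to
  \<open>window_sum\<close> and back costs the factor \<open>khinchin_const p\<close> in the
  \<open>p\<close>-th power.\<close>

lemma translates_suppression_seq:
  assumes p: "2 < p"
  shows "suppression_seq p (khinchin_const p powr (1 / p)) (\<lambda>j x. gen (x - real (Suc j)))"
proof
  have K: "0 < khinchin_const p"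
    using p by (simp add: khinchin_const_def)
  show "1 \<le> p" "0 < khinchin_const p powr (1 / p)"
    using p K by auto
  show "in_Lp p (\<lambda>x. gen (x - real (Suc j)))" for j
    by (intro in_Lp_translate gen_in_Lp p)
  show "0 < Lp_norm p (\<lambda>x. gen (x - real (Suc j)))" for j
  proof -
    \<comment> \<open>The first window met by the translate has weight
      \<open>1 / (Suc j - j) = 1\<close>, which bounds the norm away from 0.\<close>
    have "sq_fun {j} (\<lambda>_. 1) (Suc j) powr (p / 2) \<le> window_sum p {j} (\<lambda>_. 1)"
      using sum_le_suminf[OF summable_window[OF p, of "{j}" "\<lambda>_. 1"], of "{Suc j}"]
      by (simp add: window_sum_def)
    also have "\<dots> \<le> Lp_norm p (translate_sum {j} (\<lambda>_. 1)) powr p"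
      by (intro window_sum_le p) simp
    finally have "Lp_norm p (translate_sum {j} (\<lambda>_. 1)) \<noteq> 0"
      by (auto simp: sq_fun_def)
    then show ?thesis
      by (simp add: translate_sum_def[abs_def] order_less_le)
  qed
  show "Lp_norm p (\<lambda>x. \<Sum>j\<in>G. a j * gen (x - real (Suc j)))
      \<le> khinchin_const p powr (1 / p) * Lp_norm p (\<lambda>x. \<Sum>j\<in>F. a j * gen (x - real (Suc j)))"
    if F: "finite F" and G: "G \<subseteq> F" for F G a
  proof -
    have "finite G"
      using F G by (rule finite_subset[rotated])
    have "Lp_norm p (translate_sum G a) powr p \<le> khinchin_const p * window_sum p G a"
      by (rule window_sum_ge) fact+
    also have "\<dots> \<le> khinchin_const p * window_sum p F a"
      using K p F \<open>finite G\<close> unfolding window_sum_def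
      by (intro mult_left_mono suminf_le summable_window powr_mono2 sq_fun_mono F G) auto
    also have "\<dots> \<le> khinchin_const p * Lp_norm p (translate_sum F a) powr p"
      using K by (intro mult_left_mono window_sum_le p F) auto
    also have "\<dots> = (khinchin_const p powr (1 / p) * Lp_norm p (translate_sum F a)) powr p"
      using K p by (simp add: powr_mult powr_powr)
    finally have "Lp_norm p (translate_sum G a) \<le> khinchin_const p powr (1 / p) * Lp_norm p (translate_sum F a)"
      using p by (subst Lp_norm_le_iff) (auto simp: Lp_norm_powr)
    then show ?thesis
      by (simp add: translate_sum_def[abs_def])
  qed
qed

section \<open>Comparison with the basis of \<open>\<ell>\<^sup>p(\<ell>\<^sup>2)\<close>\<close>

text \<open>Each of the \<open>card A\<close> summands is at most
  \<open>(\<Sum>j\<in>A. y j powr q) powr (1 / q)\<close>.\<close>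

lemma sum_powr_le:
  fixes y :: "'a \<Rightarrow> real"
  assumes "finite A" "\<And>j. j \<in> A \<Longrightarrow> 0 \<le> y j" "0 < q"
  shows "(\<Sum>j\<in>A. y j) powr q \<le> real (card A) powr q * (\<Sum>j\<in>A. y j powr q)"
proof -
  define s where "s = (\<Sum>j\<in>A. y j powr q)"
  have s: "0 \<le> s"
    by (simp add: s_def sum_nonneg)
  have "y j \<le> s powr (1 / q)" if "j \<in> A" for j
  proof -
    have "y j powr q \<le> s"
      unfolding s_def using assms that by (intro member_le_sum) auto
    then have "(y j powr q) powr (1 / q) \<le> s powr (1 / q)"
      using assms by (intro powr_mono2) auto
    then show ?thesis
      using assms that by (simp add: powr_powr)
  qed
  then have "(\<Sum>j\<in>A. y j) \<le> real (card A) * s powr (1 / q)"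
    by (intro sum_bounded_above)
  then have "(\<Sum>j\<in>A. y j) powr q \<le> (real (card A) * s powr (1 / q)) powr q"
    using assms by (intro powr_mono2 sum_nonneg) auto
  also have "\<dots> = real (card A) powr q * s"
    using assms s by (simp add: powr_mult powr_powr)
  finally show ?thesis
    by (simp add: s_def)
qed

text \<open>For \<open>m < j\<close> the truncated difference is 0, so the shift only prepends
  zeros.\<close>

lemma sums_shift_right:
  fixes f :: "nat \<Rightarrow> real"
  assumes "f sums s" "f 0 = 0"
  shows "(\<lambda>m. f (m - j)) sums s"
  using sums_zero_iff_shift[of j "\<lambda>m. f (m - j)" s] assms by simp

text \<open>Terms at distance below \<open>D\<close> of a set contained in one residue class modulo \<open>D\<close> do not
  overlap, so only the far terms cost the factor \<open>card F powr q\<close>.\<close>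

lemma sq_fun_sparse_le:
  assumes q: "1 < q" and "0 < D" and F: "finite F" and cls: "\<And>j. j \<in> F \<Longrightarrow> j mod D = r"
  defines "\<phi> \<equiv> \<lambda>k::nat. real k powr - q"
  defines "\<psi> \<equiv> \<lambda>k::nat. if D \<le> k then real k powr - q else 0"
  shows "sq_fun F (\<lambda>_. 1) m powr q
    \<le> 2 powr q * ((\<Sum>j\<in>F. \<phi> (m - j)) + real (card F) powr q * (\<Sum>j\<in>F. \<psi> (m - j)))"
proof -
  define y where "y j = 1 / real (m - j)" for j
  define N where "N = {j \<in> F. j < m \<and> m - j < D}"
  define R where "R = {j \<in> F. D \<le> m - j}"
  have y: "0 \<le> y j" "y j powr q = \<phi> (m - j)" for j
    by (simp_all add: y_def \<phi>_def powr_divide powr_minus_divide)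
  have fin: "finite N" "finite R" "N \<subseteq> F" "R \<subseteq> F"
    using F by (auto simp: N_def R_def)
  have "sq_fun F (\<lambda>_. 1) m = (\<Sum>j\<in>N \<union> R. y j)"
    unfolding sq_fun_def using F
    by (intro sum.mono_neutral_cong_right) (auto simp: N_def R_def y_def)
  also have "\<dots> = (\<Sum>j\<in>N. y j) + (\<Sum>j\<in>R. y j)"
    using fin by (intro sum.union_disjoint) (auto simp: N_def R_def)
  finally have "sq_fun F (\<lambda>_. 1) m powr q = \<bar>(\<Sum>j\<in>N. y j) + (\<Sum>j\<in>R. y j)\<bar> powr q"
    by (simp add: y sum_nonneg)
  also have "\<dots> \<le> 2 powr q * ((\<Sum>j\<in>N. y j) powr q + (\<Sum>j\<in>R. y j) powr q)"
    using abs_add_powr_le[of q "\<Sum>j\<in>N. y j" "\<Sum>j\<in>R. y j"] q by (simp add: y sum_nonneg)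
  also have "\<dots> \<le> 2 powr q * ((\<Sum>j\<in>F. \<phi> (m - j)) + real (card F) powr q * (\<Sum>j\<in>F. \<psi> (m - j)))"
  proof (intro mult_left_mono add_mono)
    have "i = j" if "i \<in> N" "j \<in> N" for i j
    proof -
      have "i mod D = j mod D" "i < m" "j < m" "m - i < D" "m - j < D"
        using that cls by (auto simp: N_def)
      then show ?thesis
        using \<open>0 < D\<close>
      proof (induction i j rule: linorder_wlog)
        case (le i j)
        then have "D dvd j - i" "j - i < D"
          using mod_eq_dvd_iff_nat[of i j D] by auto
        then show ?case
          using le by (auto dest: dvd_imp_le)
      qed auto
    qed
    then have "card N \<le> 1"
      by (auto simp: card_le_Suc0_iff_eq fin)
    then have "real (card N) powr q \<le> 1"
      using q powr_mono2[of q "real (card N)" 1] by simp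
    then have "real (card N) powr q * (\<Sum>j\<in>N. y j powr q) \<le> 1 * (\<Sum>j\<in>F. y j powr q)"
      using F fin by (intro mult_mono sum_mono2 sum_nonneg) auto
    then show "(\<Sum>j\<in>N. y j) powr q \<le> (\<Sum>j\<in>F. \<phi> (m - j))"
      using sum_powr_le[of N y q] fin q y by simp
    have "(\<Sum>j\<in>R. y j) powr q \<le> real (card R) powr q * (\<Sum>j\<in>R. y j powr q)"
      using fin q y by (intro sum_powr_le) auto
    also have "(\<Sum>j\<in>R. y j powr q) = (\<Sum>j\<in>F. \<psi> (m - j))"
      using F by (intro sum.mono_neutral_cong_left) (auto simp: R_def \<psi>_def y \<phi>_def)
    also have "real (card R) powr q * (\<Sum>j\<in>F. \<psi> (m - j)) \<le> real (card F) powr q * (\<Sum>j\<in>F. \<psi> (m - j))"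
      using q F fin by (intro mult_right_mono powr_mono2 sum_nonneg) (auto simp: \<psi>_def intro: card_mono)
    finally show "(\<Sum>j\<in>R. y j) powr q \<le> real (card F) powr q * (\<Sum>j\<in>F. \<psi> (m - j))" .
  qed simp
  finally show ?thesis .
qed

text \<open>Linear growth in \<open>M\<close>, as for the basis of \<open>l^p\<close>. It matters
  that \<open>C\<close> is fixed before \<open>M\<close>; only the spacing \<open>D\<close> depends
  on \<open>M\<close>.\<close>

lemma window_sum_sparse_le:
  assumes p: "2 < p"
  obtains C where "0 < C" "\<And>M. 0 < M \<Longrightarrow> \<exists>D>0. \<forall>F r. finite F \<and> card F = M \<and> (\<forall>j\<in>F. j mod D = r) \<longrightarrow>
    window_sum p F (\<lambda>_. 1) \<le> C * real M"
proof -
  define q where "q = p / 2"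
  have q: "1 < q" using p by (simp add: q_def)
  define \<phi> where "\<phi> k = real k powr - q" for k :: nat
  have sum: "summable \<phi>"
    unfolding \<phi>_def using q by (simp add: summable_real_powr_iff)
  define W where "W = suminf \<phi>"
  have "0 \<le> W"
    unfolding W_def using sum by (intro suminf_nonneg) (auto simp: \<phi>_def)
  show ?thesis
  proof
    \<comment> \<open>For each index, \<open>W\<close> pays for the full series of weights and the
      summand 1 for the far terms.\<close>
    show "0 < 2 powr q * (W + 1)"
      using \<open>0 \<le> W\<close> by simp
    fix M :: nat assume M: "0 < M"
    \<comment> \<open>A tail of the weights below \<open>M powr - q\<close> absorbs the factor
      \<open>card F powr q\<close> of the far terms in \<open>sq_fun_sparse_le\<close>.\<close>
    obtain D0 where D0: "\<And>n. D0 \<le> n \<Longrightarrow> norm (\<Sum>i. \<phi> (i + n)) < real M powr - q"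
      using suminf_exist_split[OF _ sum, of "real M powr - q"] M by auto
    define D where "D = Suc D0"
    define \<psi> where "\<psi> k = (if D \<le> k then real k powr - q else 0)" for k :: nat
    define \<tau> where "\<tau> = (\<Sum>i. \<phi> (i + D))"
    have "(\<lambda>i. \<phi> (i + D)) sums \<tau>"
      unfolding \<tau>_def using sum by (intro summable_sums) (simp add: summable_iff_shift)
    moreover have "\<phi> (i + D) = \<psi> (i + D)" for i
      by (simp add: \<phi>_def \<psi>_def)
    ultimately have "(\<lambda>i. \<psi> (i + D)) sums \<tau>"
      by (simp only:)
    then have \<psi>: "\<psi> sums \<tau>"
      by (rule sums_zero_iff_shift[THEN iffD1, rotated]) (simp add: \<psi>_def)
    have \<tau>: "real M powr q * \<tau> \<le> 1"
    proof -
      have "real M powr q * \<tau> \<le> real M powr q * real M powr - q"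
        using D0[of D] by (intro mult_left_mono) (auto simp: D_def \<tau>_def)
      then show ?thesis
        using M by (simp flip: powr_add)
    qed
    have "window_sum p F (\<lambda>_. 1) \<le> 2 powr q * (W + 1) * real M"
      if F: "finite F" "card F = M" "\<forall>j\<in>F. j mod D = r" for F r
    proof -
      have "(\<lambda>m. \<phi> (m - j)) sums W" "(\<lambda>m. \<psi> (m - j)) sums \<tau>" for j
        using sums_shift_right[OF summable_sums[OF sum], of j] sums_shift_right[OF \<psi>, of j]
        by (simp_all add: W_def \<phi>_def \<psi>_def D_def)
      then have "(\<lambda>m. 2 powr q * ((\<Sum>j\<in>F. \<phi> (m - j)) + real M powr q * (\<Sum>j\<in>F. \<psi> (m - j))))
          sums (2 powr q * ((\<Sum>j\<in>F. W) + real M powr q * (\<Sum>j\<in>F. \<tau>)))"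
        by (intro sums_mult sums_add sums_sum)
      moreover have "sq_fun F (\<lambda>_. 1) m powr (p / 2)
          \<le> 2 powr q * ((\<Sum>j\<in>F. \<phi> (m - j)) + real M powr q * (\<Sum>j\<in>F. \<psi> (m - j)))" for m
        using sq_fun_sparse_le[OF q, of D F r m] F by (simp add: \<phi>_def \<psi>_def q_def D_def)
      ultimately have "window_sum p F (\<lambda>_. 1) \<le> 2 powr q * ((\<Sum>j\<in>F. W) + real M powr q * (\<Sum>j\<in>F. \<tau>))"
        unfolding window_sum_def
        by (intro sums_le[OF _ summable_sums[OF summable_window[OF p F(1)]]]) auto
      also have "\<dots> = 2 powr q * (real M * (W + real M powr q * \<tau>))"
        using F by (simp add: algebra_simps)
      also have "\<dots> \<le> 2 powr q * (real M * (W + 1))"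
        using \<tau> by (intro mult_left_mono) auto
      finally show ?thesis
        by (simp add: mult_ac)
    qed
    moreover have "0 < D"
      by (simp add: D_def)
    ultimately show "\<exists>D>0. \<forall>F r. finite F \<and> card F = M \<and> (\<forall>j\<in>F. j mod D = r) \<longrightarrow>
        window_sum p F (\<lambda>_. 1) \<le> 2 powr q * (W + 1) * real M"
      by blast
  qed
qed

text \<open>In each of the \<open>N\<close> windows with \<open>N \<le> m < 2 * N\<close>, the
  weights \<open>1 / (m - j)\<close> with \<open>j < m\<close> add up to \<open>harm m\<close>,
  which is at least \<open>harm N\<close>.\<close>

lemma window_sum_interval_ge:
  assumes p: "2 < p"
  shows "real N * harm N powr (p / 2) \<le> window_sum p {..<2 * N} (\<lambda>_. 1)"
proof -
  have "harm N powr (p / 2) \<le> sq_fun {..<2 * N} (\<lambda>_. 1) m powr (p / 2)" if "m \<in> {N..<2 * N}" for m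
  proof -
    have "harm N \<le> (harm m :: real)"
      using that by (intro harm_mono) auto
    also have "harm m = (\<Sum>j<m. 1 / real (m - j))"
    proof -
      have "harm m = (\<Sum>j<m. 1 / real (Suc j))"
        by (simp add: harm_def sum.atLeast1_atMost_eq inverse_eq_divide)
      also have "\<dots> = (\<Sum>j<m. 1 / real (Suc (m - Suc j)))"
        by (rule sum.nat_diff_reindex[symmetric])
      also have "\<dots> = (\<Sum>j<m. 1 / real (m - j))"
        by (intro sum.cong) (auto simp: Suc_diff_Suc simp del: of_nat_Suc of_nat_diff)
      finally show ?thesis .
    qed
    also have "\<dots> \<le> sq_fun {..<2 * N} (\<lambda>_. 1) m"
      unfolding sq_fun_def using that by (subst power_one) (intro sum_mono2; auto)
    finally show ?thesis
      using p by (intro powr_mono2) (auto simp: harm_nonneg)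
  qed
  then have "real (card {N..<2 * N}) * harm N powr (p / 2)
      \<le> (\<Sum>m\<in>{N..<2 * N}. sq_fun {..<2 * N} (\<lambda>_. 1) m powr (p / 2))"
    by (intro sum_bounded_below) auto
  also have "\<dots> \<le> window_sum p {..<2 * N} (\<lambda>_. 1)"
    unfolding window_sum_def by (intro sum_le_suminf summable_window p) auto
  finally show ?thesis
    by simp
qed

section \<open>Class sizes and the contradiction to equivalence\<close>

lemma lp_l2_norm_one_powr:
  assumes "0 < p"
  shows "lp_l2_norm p \<sigma> F (\<lambda>_. 1) powr p
    = (\<Sum>n\<in>fst ` \<sigma> ` F. real (card {j \<in> F. fst (\<sigma> j) = n}) powr (p / 2))"
  using assms by (simp add: lp_l2_norm_def powr_powr sum_nonneg)

lemma lp_l2_norm_nonneg: "0 \<le> lp_l2_norm p \<sigma> F a"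
  by (simp add: lp_l2_norm_def)

lemma translates_not_equiv:
  assumes p: "2 < p"
  shows "\<not> equiv_to_lp_l2_subseq p (\<lambda>j x. gen (x - real (Suc j)))"
proof
  assume "equiv_to_lp_l2_subseq p (\<lambda>j x. gen (x - real (Suc j)))"
  then obtain \<sigma> A B where AB: "0 < A" "0 < B" and equiv: "\<forall>F a. finite F \<longrightarrow>
      A * lp_l2_norm p \<sigma> F a \<le> Lp_norm p (\<lambda>x. \<Sum>j\<in>F. a j * gen (x - real (Suc j))) \<and>
      Lp_norm p (\<lambda>x. \<Sum>j\<in>F. a j * gen (x - real (Suc j))) \<le> B * lp_l2_norm p \<sigma> F a"
    unfolding equiv_to_lp_l2_subseq_def by blast
  then have low: "A * lp_l2_norm p \<sigma> F a \<le> Lp_norm p (translate_sum F a)"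
    and up: "Lp_norm p (translate_sum F a) \<le> B * lp_l2_norm p \<sigma> F a" if "finite F" for F a
    using that by (simp_all add: translate_sum_def[abs_def] del: of_nat_Suc)
  define q where "q = p / 2"
  have q: "1 < q" using p by (simp add: q_def)
  \<comment> \<open>The \<open>p\<close>-th power of the norm in \<open>l^p(l^2)\<close>; from here
    on only coefficients equal to 1 are tested.\<close>
  define P where "P F = (\<Sum>n\<in>fst ` \<sigma> ` F. real (card {j \<in> F. fst (\<sigma> j) = n}) powr q)" for F
  have K: "0 < khinchin_const p"
    using p by (simp add: khinchin_const_def)
  have low': "A powr p * P F \<le> khinchin_const p * window_sum p F (\<lambda>_. 1)" if "finite F" for F
  proof -
    have "A powr p * P F = (A * lp_l2_norm p \<sigma> F (\<lambda>_. 1)) powr p"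
      using AB p by (simp add: powr_mult lp_l2_norm_nonneg lp_l2_norm_one_powr P_def q_def)
    also have "\<dots> \<le> Lp_norm p (translate_sum F (\<lambda>_. 1)) powr p"
      using AB p that by (intro powr_mono2 low) (auto simp: lp_l2_norm_nonneg)
    also have "\<dots> \<le> khinchin_const p * window_sum p F (\<lambda>_. 1)"
      using p that by (rule window_sum_ge)
    finally show ?thesis .
  qed
  have up': "window_sum p F (\<lambda>_. 1) \<le> B powr p * P F" if "finite F" for F
  proof -
    have "window_sum p F (\<lambda>_. 1) \<le> Lp_norm p (translate_sum F (\<lambda>_. 1)) powr p"
      using p that by (rule window_sum_le)
    also have "\<dots> \<le> (B * lp_l2_norm p \<sigma> F (\<lambda>_. 1)) powr p"
      using p that by (intro powr_mono2 up) auto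
    also have "\<dots> = B powr p * P F"
      using AB p by (simp add: powr_mult lp_l2_norm_nonneg lp_l2_norm_one_powr P_def q_def)
    finally show ?thesis .
  qed
  obtain C where C: "0 < C" "\<And>M. 0 < M \<Longrightarrow> \<exists>D>0. \<forall>F r. finite F \<and> card F = M \<and> (\<forall>j\<in>F. j mod D = r) \<longrightarrow>
      window_sum p F (\<lambda>_. 1) \<le> C * real M"
    using window_sum_sparse_le[OF p] by metis
  \<comment> \<open>For \<open>M\<close> sparse indices in one class, equivalence would give
    \<open>M powr q \<le> c * M\<close>. Hence \<open>M\<close> is chosen with
    \<open>M powr (q - 1) > c\<close>, which is possible since \<open>q > 1\<close>.\<close>
  define c where "c = khinchin_const p * C / A powr p"
  have "0 < c"
    using K C AB by (simp add: c_def)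
  define M where "M = Suc (nat \<lceil>c powr (1 / (q - 1))\<rceil>)"
  have M: "0 < M" "c powr (1 / (q - 1)) < real M"
    unfolding M_def by linarith+
  have "c = (c powr (1 / (q - 1))) powr (q - 1)"
    using \<open>0 < c\<close> q by (simp add: powr_powr)
  also have "\<dots> < real M powr (q - 1)"
    using M q by (intro powr_less_mono2) auto
  finally have cM: "c * real M < real M powr q"
    using M by (simp add: powr_diff field_simps)
  obtain D where D: "0 < D" "\<And>F r. finite F \<Longrightarrow> card F = M \<Longrightarrow> (\<forall>j\<in>F. j mod D = r) \<Longrightarrow>
      window_sum p F (\<lambda>_. 1) \<le> C * real M"
    using C(2)[OF M(1)] by blast
  \<comment> \<open>Otherwise some \<open>M\<close> of these indices form a set \<open>F\<close>
    with \<open>P F = M powr q\<close>, while sparseness bounds \<open>window_sum\<close> by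
    \<open>C * M\<close>; this contradicts \<open>cM\<close>.\<close>
  have small: "card {j \<in> G. j mod D = r} \<le> M"
    if G: "finite G" "\<And>j. j \<in> G \<Longrightarrow> fst (\<sigma> j) = n" for G n r
  proof (rule ccontr)
    assume "\<not> ?thesis"
    then obtain F where F: "F \<subseteq> {j \<in> G. j mod D = r}" "card F = M" "finite F"
      using obtain_subset_with_card_n[of M "{j \<in> G. j mod D = r}"] by (metis nat_le_linear)
    have "F \<noteq> {}"
      using F M by auto
    then have "fst ` \<sigma> ` F = {n}" "{j \<in> F. fst (\<sigma> j) = n} = F"
      using F G by (force simp: image_image)+
    then have "P F = real M powr q"
      using F by (simp add: P_def)
    then have "A powr p * real M powr q \<le> khinchin_const p * window_sum p F (\<lambda>_. 1)"
      using low'[OF F(3)] by simp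
    also have "\<dots> \<le> khinchin_const p * (C * real M)"
      using K F D(2)[of F r] by (intro mult_left_mono) auto
    finally have "real M powr q \<le> c * real M"
      using AB by (simp add: c_def field_simps)
    then show False
      using cM by simp
  qed
  \<comment> \<open>Split the class into its \<open>D\<close> residue classes.\<close>
  have bounded: "card {j \<in> F. fst (\<sigma> j) = n} \<le> D * M" if "finite F" for F n
  proof -
    let ?G = "{j \<in> F. fst (\<sigma> j) = n}"
    have "?G = (\<Union>r<D. {j \<in> ?G. j mod D = r})"
      using D by auto
    then have "card ?G \<le> (\<Sum>r<D. card {j \<in> ?G. j mod D = r})"
      using card_UN_le[of "{..<D}" "\<lambda>r. {j \<in> ?G. j mod D = r}"] by simp
    also have "\<dots> \<le> (\<Sum>r<D. M)"
      using that by (intro sum_mono small[of _ n]) auto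
    finally show ?thesis
      by simp
  qed
  \<comment> \<open>The interval \<open>{..<2 * N}\<close> meets at most \<open>2 * N\<close>
    classes, each in at most \<open>D * M\<close> indices; \<open>R\<close> is the resulting bound
    divided by \<open>N\<close>.\<close>
  define R where "R = B powr p * (real (D * M) powr q * 2)"
  have harm: "harm N powr q \<le> R" if "0 < N" for N
  proof -
    have "card (fst ` \<sigma> ` {..<2 * N}) \<le> 2 * N"
      by (metis card_image_le card_lessThan finite_imageI finite_lessThan order_trans)
    have "real N * harm N powr q \<le> window_sum p {..<2 * N} (\<lambda>_. 1)"
      unfolding q_def by (rule window_sum_interval_ge[OF p])
    also have "\<dots> \<le> B powr p * P {..<2 * N}"
      by (rule up') simp
    also have "P {..<2 * N} \<le> real (card (fst ` \<sigma> ` {..<2 * N})) * real (D * M) powr q"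
      unfolding P_def using bounded[of "{..<2 * N}"] q
      by (intro sum_bounded_above powr_mono2) (auto simp del: of_nat_mult)
    also have "\<dots> \<le> real (2 * N) * real (D * M) powr q"
      using \<open>card _ \<le> _\<close> by (intro mult_right_mono) (simp_all only: of_nat_le_iff, simp)
    finally have "real N * harm N powr q \<le> real N * R"
      using AB by (simp add: R_def mult_ac)
    then show ?thesis
      using that by simp
  qed
  \<comment> \<open>Large enough that \<open>ln (N + 1)\<close>, a lower bound for
    \<open>harm N\<close>, exceeds \<open>R powr (1 / q)\<close>.\<close>
  define N where "N = nat \<lceil>exp (R powr (1 / q) + 1)\<rceil>"
  have N: "exp (R powr (1 / q) + 1) \<le> real N"
    unfolding N_def by linarith
  then have "0 < N"
    using exp_gt_zero[of "R powr (1 / q) + 1"] by (intro gr0I) auto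
  have "R powr (1 / q) + 1 \<le> ln (real N + 1)"
    using N by (subst ln_ge_iff) auto
  also have "\<dots> \<le> harm N"
    by (rule ln_le_harm)
  also have "\<dots> = (harm N powr q) powr (1 / q)"
    using q by (simp add: powr_powr harm_nonneg)
  also have "\<dots> \<le> R powr (1 / q)"
    using q harm[OF \<open>0 < N\<close>] by (intro powr_mono2) auto
  finally show False
    by simp
qed

theorem theorem5p2:
  fixes p :: real
  assumes "2 < p"
  shows "\<exists>g. in_Lp p g \<and> uncond_basic_seq p (\<lambda>j x. g (x - real (Suc j))) \<and>
             \<not> equiv_to_lp_l2_subseq p (\<lambda>j x. g (x - real (Suc j)))"
  using gen_in_Lp[OF assms] translates_not_equiv[OF assms]
    suppression_seq.uncond_basic[OF translates_suppression_seq[OF assms]] by blast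

end
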